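(* Consider mandatory XAI regulation in the duopoly model described in the context. For each of the two horizontal differentiations of the firms ('max' and 'min') there exist parameters $\beta>0$, $t>0$ and a level $\xi\in[0,1)$ such that mandating full explanations makes everyone worse off than mandating $\xi$: the profit of each firm and the total utility of customers are all strictly smaller when the policy-maker mandates level $1$ than when it mandates level $\xi$.
   Context: Model. Two firms $i=1,2$; parameters $\beta>0$ (quality cost) and $t>0$ (misfit cost). Customers $(x,\theta)$ are uniformly distributed on $[0,1]^2$. A customer buying from firm $i$ with quality $q_i\ge 0$, price $p_i\ge0$, XAI level $\xi_i\in[0,1]$ and location (XAI method) $e_i$ has utility $u_i=V+\theta q_i-p_i-t(1-\xi_i)|x-e_i|$, where the reservation value $V$ is large enough that every customer's utility is positive in equilibrium and every customer makes exactly one purchase, from the firm giving the higher utility. Firm 1 is the high-quality firm ($q_1\ge q_2$). Locations are exogenous: 'max' means $e_1=0,e_2=1$; 'min' means $e_1=e_2=1/2$. The demand $d_i$ is the area of the set of customers buying from $i$; profit is $\pi_i=p_id_i-\beta q_i^2$. Customers' total utility is the integral of customers' utilities over $[0,1]^2$. Mandatory regulation. The policy-maker chooses $\xi\in[0,1]$ and both firms must offer $\xi_1=\xi_2=\xi$; firms then choose qualities and afterwards prices. A market is quality-dominated (Q) if for every $x\in[0,1]$ there is an indifferent customer, and explanation-dominated (E) if for every $\theta\in[0,1]$ there is an indifferent customer. The possible equilibria are: (Q2; 'max' or 'min') possible iff $\beta t\,\xi<4/9$: $p_1=\frac{4}{27\beta}$, $p_2=\frac{2}{27\beta}$, $q_1=\frac{2}{9\beta}$,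 $q_2=0$, $\pi_1=\frac{4}{81\beta}$, $\pi_2=\frac{2}{81\beta}$. (E2; 'max' only) possible iff $\beta t>\frac{1}{6(2\xi^2-7\xi+6)}$: $p_1=p_2=t(1-\xi)$, $q_1=q_2=\frac1{12\beta}$, $\pi_1=\pi_2=\frac{t(1-\xi)}2-\frac1{144\beta}$. Under 'min' no explanation-dominated market is possible. If both markets are possible, firms choose the one giving them higher profits. If no market is possible, or profits in the resulting market are negative, the firms leave: there is no market, profits are zero and customers' total utility is zero. *)

theory Defs
  imports "HOL-Analysis.Analysis"
begin

datatype firm = Firm1 | Firm2

fun rival :: "firm \<Rightarrow> firm" where
  "rival Firm1 = Firm2"
| "rival Firm2 = Firm1"

datatype differentiation = MaxDiff | MinDiff

fun location :: "differentiation \<Rightarrow> firm \<Rightarrow> real" where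
  "location MaxDiff Firm1 = 0"
| "location MaxDiff Firm2 = 1"
| "location MinDiff i = 1 / 2"

text \<open>The two kinds of market: in a quality-dominated market every \<open>x\<close> admits an indifferent
  customer, in an explanation-dominated market every \<open>\<theta>\<close> does.\<close>

datatype market = QualityDom | ExplanationDom

text \<open>The equilibria under a level \<open>\<xi>\<close> mandated for both firms are taken as data of the model:
  when a market is possible, and the prices, qualities and profits of the firms in it.\<close>

fun market_possible :: "differentiation \<Rightarrow> real \<Rightarrow> real \<Rightarrow> real \<Rightarrow> market \<Rightarrow> bool" where
  "market_possible h \<beta> t \<xi> QualityDom \<longleftrightarrow> \<beta> * t * \<xi> < 4 / 9"
| "market_possible h \<beta> t \<xi> ExplanationDom \<longleftrightarrow>
     h = MaxDiff \<and> \<beta> * t > 1 / (6 * (2 * \<xi>\<^sup>2 - 7 * \<xi> + 6))"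

fun price :: "real \<Rightarrow> real \<Rightarrow> real \<Rightarrow> market \<Rightarrow> firm \<Rightarrow> real" where
  "price \<beta> t \<xi> QualityDom Firm1 = 4 / (27 * \<beta>)"
| "price \<beta> t \<xi> QualityDom Firm2 = 2 / (27 * \<beta>)"
| "price \<beta> t \<xi> ExplanationDom i = t * (1 - \<xi>)"

fun quality :: "real \<Rightarrow> market \<Rightarrow> firm \<Rightarrow> real" where
  "quality \<beta> QualityDom Firm1 = 2 / (9 * \<beta>)"
| "quality \<beta> QualityDom Firm2 = 0"
| "quality \<beta> ExplanationDom i = 1 / (12 * \<beta>)"

fun equilibrium_profit :: "real \<Rightarrow> real \<Rightarrow> real \<Rightarrow> market \<Rightarrow> firm \<Rightarrow> real" where
  "equilibrium_profit \<beta> t \<xi> QualityDom Firm1 = 4 / (81 * \<beta>)"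
| "equilibrium_profit \<beta> t \<xi> QualityDom Firm2 = 2 / (81 * \<beta>)"
| "equilibrium_profit \<beta> t \<xi> ExplanationDom i = t * (1 - \<xi>) / 2 - 1 / (144 * \<beta>)"

text \<open>A customer is a pair \<open>(x, \<theta>)\<close>.\<close>

definition customers :: "(real \<times> real) set" where
  "customers = {0..1} \<times> {0..1}"

definition utility ::
    "real \<Rightarrow> differentiation \<Rightarrow> real \<Rightarrow> real \<Rightarrow> real \<Rightarrow> market \<Rightarrow> firm \<Rightarrow> real \<times> real \<Rightarrow> real" where
  "utility V h \<beta> t \<xi> m i = (\<lambda>(x, \<theta>).
     V + \<theta> * quality \<beta> m i - price \<beta> t \<xi> m i - t * (1 - \<xi>) * \<bar>x - location h i\<bar>)"

text \<open>Every customer buys exactly once, from the firm giving the higher utility.\<close>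

definition customer_utility ::
    "real \<Rightarrow> differentiation \<Rightarrow> real \<Rightarrow> real \<Rightarrow> real \<Rightarrow> market \<Rightarrow> real \<times> real \<Rightarrow> real" where
  "customer_utility V h \<beta> t \<xi> m c =
     max (utility V h \<beta> t \<xi> m Firm1 c) (utility V h \<beta> t \<xi> m Firm2 c)"

text \<open>Indifferent customers are split evenly. They form a null set, except in an
  explanation-dominated market at \<open>\<xi> = 1\<close>, where both prices are \<open>0\<close> and the split does not
  affect profits. The reservation value cancels in the comparison and is set to \<open>0\<close>.\<close>

definition demand ::
    "differentiation \<Rightarrow> real \<Rightarrow> real \<Rightarrow> real \<Rightarrow> market \<Rightarrow> firm \<Rightarrow> real" where
  "demand h \<beta> t \<xi> m i =
     measure lborel {c \<in> customers. utility 0 h \<beta> t \<xi> m i c > utility 0 h \<beta> t \<xi> m (rival i) c}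
     + measure lborel {c \<in> customers. utility 0 h \<beta> t \<xi> m i c = utility 0 h \<beta> t \<xi> m (rival i) c} / 2"

definition market_profit ::
    "differentiation \<Rightarrow> real \<Rightarrow> real \<Rightarrow> real \<Rightarrow> market \<Rightarrow> firm \<Rightarrow> real" where
  "market_profit h \<beta> t \<xi> m i =
     price \<beta> t \<xi> m i * demand h \<beta> t \<xi> m i - \<beta> * (quality \<beta> m i)\<^sup>2"

text \<open>If both markets are possible, the firms do not choose one that is worse for one firm and
  no better for the other. Where the two firms rank the markets differently, either is admitted.\<close>

definition chosen_market ::
    "differentiation \<Rightarrow> real \<Rightarrow> real \<Rightarrow> real \<Rightarrow> market \<Rightarrow> bool" where
  "chosen_market h \<beta> t \<xi> m \<longleftrightarrow>
     market_possible h \<beta> t \<xi> m \<and>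
     \<not> (\<exists>m'. market_possible h \<beta> t \<xi> m' \<and>
            (\<forall>i. equilibrium_profit \<beta> t \<xi> m i \<le> equilibrium_profit \<beta> t \<xi> m' i) \<and>
            (\<exists>i. equilibrium_profit \<beta> t \<xi> m i < equilibrium_profit \<beta> t \<xi> m' i))"

text \<open>\<open>None\<close> stands for the absence of a market.\<close>

fun outcome ::
    "differentiation \<Rightarrow> real \<Rightarrow> real \<Rightarrow> real \<Rightarrow> market option \<Rightarrow> bool" where
  "outcome h \<beta> t \<xi> None \<longleftrightarrow>
     (\<forall>m. \<not> market_possible h \<beta> t \<xi> m) \<or>
     (\<exists>m. chosen_market h \<beta> t \<xi> m \<and> (\<exists>i. equilibrium_profit \<beta> t \<xi> m i < 0))"
| "outcome h \<beta> t \<xi> (Some m) \<longleftrightarrow>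
     chosen_market h \<beta> t \<xi> m \<and> (\<forall>i. equilibrium_profit \<beta> t \<xi> m i \<ge> 0)"

fun profit ::
    "differentiation \<Rightarrow> real \<Rightarrow> real \<Rightarrow> real \<Rightarrow> market option \<Rightarrow> firm \<Rightarrow> real" where
  "profit h \<beta> t \<xi> None i = 0"
| "profit h \<beta> t \<xi> (Some m) i = market_profit h \<beta> t \<xi> m i"

fun total_utility ::
    "real \<Rightarrow> differentiation \<Rightarrow> real \<Rightarrow> real \<Rightarrow> real \<Rightarrow> market option \<Rightarrow> real" where
  "total_utility V h \<beta> t \<xi> None = 0"
| "total_utility V h \<beta> t \<xi> (Some m) = (LINT c:customers|lborel. customer_utility V h \<beta> t \<xi> m c)"

definition reservation_large ::
    "real \<Rightarrow> differentiation \<Rightarrow> real \<Rightarrow> real \<Rightarrow> real \<Rightarrow> bool" where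
  "reservation_large V h \<beta> t \<xi> \<longleftrightarrow>
     (\<forall>m c. outcome h \<beta> t \<xi> (Some m) \<and> c \<in> customers \<longrightarrow> customer_utility V h \<beta> t \<xi> m c > 0)"

lemma all_firm: "(\<forall>i. P i) \<longleftrightarrow> P Firm1 \<and> P Firm2"
  by (metis firm.exhaust)

lemma ex_firm: "(\<exists>i. P i) \<longleftrightarrow> P Firm1 \<or> P Firm2"
  by (metis firm.exhaust)

lemma all_market: "(\<forall>m. P m) \<longleftrightarrow> P QualityDom \<and> P ExplanationDom"
  by (metis market.exhaust)

lemma ex_market: "(\<exists>m. P m) \<longleftrightarrow> P QualityDom \<or> P ExplanationDom"
  by (metis market.exhaust)

lemma outcome_exists: "\<exists>M. outcome h \<beta> t \<xi> M"
proof (cases "\<exists>m. market_possible h \<beta> t \<xi> m")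
  case True
  then have "\<exists>m. chosen_market h \<beta> t \<xi> m"
    unfolding chosen_market_def ex_market all_firm ex_firm by fastforce
  then show ?thesis by (metis outcome.simps not_le)
next
  case False
  then show ?thesis by (metis outcome.simps(1))
qed

lemma reservation_large_exists:
  assumes "\<beta> > 0" "t > 0"
  shows "\<exists>V0. \<forall>V\<ge>V0. \<forall>\<xi>\<in>{0..1}. reservation_large V h \<beta> t \<xi>"
proof (intro exI[of _ "4 / (27 * \<beta>) + 2 * t + 1"] allI impI ballI)
  fix V \<xi> :: real
  assume V: "4 / (27 * \<beta>) + 2 * t + 1 \<le> V" and \<xi>: "\<xi> \<in> {0..1}"
  have "0 < utility V h \<beta> t \<xi> m Firm1 (x, \<theta>)" if "x \<in> {0..1}" "\<theta> \<in> {0..1}" for m x \<theta>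
  proof -
    have "\<bar>x - location h Firm1\<bar> \<le> 1" using that by (cases h) auto
    then have "(1 - \<xi>) * \<bar>x - location h Firm1\<bar> \<le> 1 * 1"
      using \<xi> by (intro mult_mono) auto
    then have "t * ((1 - \<xi>) * \<bar>x - location h Firm1\<bar>) \<le> t * 1"
      using assms by (intro mult_left_mono) auto
    moreover have "0 \<le> \<theta> * quality \<beta> m Firm1" using that assms by (cases m) auto
    moreover have "price \<beta> t \<xi> m Firm1 \<le> 4 / (27 * \<beta>) + t"
      using assms \<xi> by (cases m) (auto simp: algebra_simps intro: add_increasing)
    ultimately show ?thesis using V by (simp add: utility_def mult.assoc)
  qed
  then show "reservation_large V h \<beta> t \<xi>"
    unfolding reservation_large_def customer_utility_def customers_def by (auto simp: less_max_iff_disj)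
qed

lemma measure_below_line:
  fixes a b :: real
  assumes ab: "0 \<le> a" "a \<le> 1" "0 \<le> a + b" "a + b \<le> 1"
  shows "measure lborel {c \<in> customers. snd c < a + b * fst c} = a + b / 2" (is ?lt)
    and "measure lborel {c \<in> customers. snd c = a + b * fst c} = 0" (is ?eq)
    and "measure lborel {c \<in> customers. snd c > a + b * fst c} = 1 - (a + b / 2)" (is ?gt)
proof -
  define f where "f x = a + b * x" for x
  have f01: "0 \<le> f x \<and> f x \<le> 1" if "x \<in> {0..1}" for x
  proof -
    have f: "f x = (1 - x) * a + x * (a + b)" by (simp add: f_def algebra_simps)
    have "0 \<le> f x" unfolding f using that ab by simp
    moreover have "f x \<le> (1 - x) * 1 + x * 1" unfolding f
      using that ab by (intro add_mono mult_left_mono) auto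
    ultimately show ?thesis by simp
  qed
  have I1: "(f has_integral a + b / 2) {0..1}"
  proof -
    have "((\<lambda>x. a + b * x) has_integral (a * 1 + b * 1\<^sup>2 / 2) - (a * 0 + b * 0\<^sup>2 / 2)) {0..1}"
      by (rule fundamental_theorem_of_calculus)
         (auto intro!: derivative_eq_intros simp: has_real_derivative_iff_has_vector_derivative[symmetric])
    then show ?thesis by (simp add: f_def[abs_def])
  qed
  have I2: "((\<lambda>x. 1 - f x) has_integral 1 - (a + b / 2)) {0..1}"
    using has_integral_diff[OF has_integral_const_real[of 1 0 1] I1] by simp
  have area: "measure lborel S = r"
    if S: "S \<in> sets borel" and int: "(g has_integral r) {0..1}"
      and g: "\<And>x. x \<in> {0..1} \<Longrightarrow> 0 \<le> g x \<and> emeasure lborel (Pair x -` S) = ennreal (g x)"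
      and out: "\<And>x. x \<notin> {0..1} \<Longrightarrow> Pair x -` S = {}" and gm: "g \<in> borel_measurable borel"
    for S :: "(real \<times> real) set" and g r
  proof -
    have S': "S \<in> sets (lborel \<Otimes>\<^sub>M lborel)" using S by (metis lborel_prod sets_lborel)
    have "emeasure lborel S = emeasure (lborel \<Otimes>\<^sub>M lborel) S" by (simp add: lborel_prod)
    also have "\<dots> = (\<integral>\<^sup>+x. emeasure lborel (Pair x -` S) \<partial>lborel)"
      by (rule lborel.emeasure_pair_measure_alt[OF S'])
    also have "\<dots> = (\<integral>\<^sup>+x. ennreal (g x) * indicator {0..1} x \<partial>lborel)"
      by (intro nn_integral_cong) (use g out in \<open>auto simp: indicator_def\<close>)
    also have "\<dots> = ennreal r"
      using nn_integral_has_integral_lebesgue'[OF _ int] g gm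
      by (simp add: nn_integral_completion measurable_completion)
    finally show ?thesis
      using has_integral_nonneg[OF int] g by (simp add: measure_def)
  qed
  have closed_eq: "{c \<in> customers. P c} = {0..1} \<times> {0..1} \<inter> {c. P c}" for P
    by (auto simp: customers_def)
  have meas: "{c \<in> customers. snd c < f (fst c)} \<in> sets borel"
             "{c \<in> customers. snd c = f (fst c)} \<in> sets borel"
             "{c \<in> customers. snd c > f (fst c)} \<in> sets borel"
    unfolding closed_eq f_def
    by (intro sets.Int borel_closed borel_open closed_Times closed_atLeastAtMost
          open_Collect_less closed_Collect_eq continuous_intros)+
  have sl: "Pair x -` {c \<in> customers. snd c < f (fst c)} = {0..<f x}"
           "Pair x -` {c \<in> customers. snd c = f (fst c)} = {f x}"
           "Pair x -` {c \<in> customers. snd c > f (fst c)} = {f x<..1}" if "x \<in> {0..1}" for x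
    using that f01[OF that] by (auto simp: customers_def)
  have out: "Pair x -` {c \<in> customers. P c} = {}" if "x \<notin> {0..1}" for x P
    using that by (auto simp: customers_def)
  have fm: "f \<in> borel_measurable borel" by (simp add: f_def[abs_def])
  show ?lt unfolding f_def[symmetric]
    by (rule area[OF meas(1) I1 _ out fm]) (use sl(1) f01 in auto)
  show ?eq unfolding f_def[symmetric]
    by (rule area[OF meas(2) has_integral_0 _ out]) (use sl(2) in auto)
  show ?gt unfolding f_def[symmetric]
    by (rule area[OF meas(3) I2 _ out]) (use sl(3) f01 fm in auto)
qed

definition quality_dominated ::
    "differentiation \<Rightarrow> real \<Rightarrow> real \<Rightarrow> real \<Rightarrow> market \<Rightarrow> bool" where
  "quality_dominated h \<beta> t \<xi> m \<longleftrightarrow>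
     (\<forall>x\<in>{0..1}. \<exists>\<theta>\<in>{0..1}. utility 0 h \<beta> t \<xi> m Firm1 (x, \<theta>) = utility 0 h \<beta> t \<xi> m Firm2 (x, \<theta>))"

text \<open>The profits listed with the equilibria are the ones generated by demand, as long as the
  quality-dominated market is indeed quality-dominated.\<close>

lemma market_profit_quality:
  assumes "\<beta> > 0" "quality_dominated h \<beta> t \<xi> QualityDom"
  shows "market_profit h \<beta> t \<xi> QualityDom i = equilibrium_profit \<beta> t \<xi> QualityDom i"
proof -
  define b where "b = (if h = MaxDiff then 9 * \<beta> * t * (1 - \<xi>) else 0)"
  have diff: "utility 0 h \<beta> t \<xi> QualityDom Firm1 c - utility 0 h \<beta> t \<xi> QualityDom Firm2 c
      = 2 / (9 * \<beta>) * (snd c - ((1 / 3 - b / 2) + b * fst c))" if "fst c \<in> {0..1}" for c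
    using that assms(1) by (cases h; cases c) (auto simp: utility_def b_def field_simps)
  have sgn: "0 < 2 / (9 * \<beta>)" using assms(1) by simp
  have cmp: "utility 0 h \<beta> t \<xi> QualityDom Firm1 c > utility 0 h \<beta> t \<xi> QualityDom Firm2 c
        \<longleftrightarrow> snd c > (1 / 3 - b / 2) + b * fst c"
      "utility 0 h \<beta> t \<xi> QualityDom Firm1 c < utility 0 h \<beta> t \<xi> QualityDom Firm2 c
        \<longleftrightarrow> snd c < (1 / 3 - b / 2) + b * fst c"
      "utility 0 h \<beta> t \<xi> QualityDom Firm1 c = utility 0 h \<beta> t \<xi> QualityDom Firm2 c
        \<longleftrightarrow> snd c = (1 / 3 - b / 2) + b * fst c" if "fst c \<in> {0..1}" for c
    using diff[OF that] zero_less_mult_iff[of "2 / (9 * \<beta>)" "snd c - ((1 / 3 - b / 2) + b * fst c)"]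
      mult_less_0_iff[of "2 / (9 * \<beta>)" "snd c - ((1 / 3 - b / 2) + b * fst c)"]
      mult_eq_0_iff[of "2 / (9 * \<beta>)" "snd c - ((1 / 3 - b / 2) + b * fst c)"] sgn
    by linarith+
  have line: "1 / 3 - b / 2 + b * x \<in> {0..1}" if "x \<in> {0..1}" for x
    using assms(2) that cmp(3)[of "(x, _)"] unfolding quality_dominated_def by fastforce
  have b: "0 \<le> 1 / 3 - b / 2" "1 / 3 - b / 2 \<le> 1" "0 \<le> 1 / 3 - b / 2 + b" "1 / 3 - b / 2 + b \<le> 1"
    using line[of 0] line[of 1] by auto
  have sets: "{c \<in> customers. utility 0 h \<beta> t \<xi> QualityDom Firm1 c > utility 0 h \<beta> t \<xi> QualityDom Firm2 c}
        = {c \<in> customers. snd c > (1 / 3 - b / 2) + b * fst c}"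
      "{c \<in> customers. utility 0 h \<beta> t \<xi> QualityDom Firm1 c < utility 0 h \<beta> t \<xi> QualityDom Firm2 c}
        = {c \<in> customers. snd c < (1 / 3 - b / 2) + b * fst c}"
      "{c \<in> customers. utility 0 h \<beta> t \<xi> QualityDom Firm1 c = utility 0 h \<beta> t \<xi> QualityDom Firm2 c}
        = {c \<in> customers. snd c = (1 / 3 - b / 2) + b * fst c}"
    using cmp by (auto simp: customers_def)
  have "demand h \<beta> t \<xi> QualityDom Firm1 = 2 / 3"
    using measure_below_line[OF b] sets by (simp add: demand_def)
  moreover have "demand h \<beta> t \<xi> QualityDom Firm2 = 1 / 3"
    using measure_below_line[OF b] sets
    by (simp add: demand_def eq_commute[of "utility 0 h \<beta> t \<xi> QualityDom Firm2 _"])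
  ultimately show ?thesis using assms(1)
    by (cases i) (simp_all add: market_profit_def power2_eq_square field_simps)
qed

lemma market_profit_explanation:
  assumes "\<beta> > 0" "t > 0" "\<xi> \<le> 1"
  shows "market_profit MaxDiff \<beta> t \<xi> ExplanationDom i = equilibrium_profit \<beta> t \<xi> ExplanationDom i"
proof (cases "\<xi> = 1")
  case True
  then show ?thesis using assms
    by (simp add: market_profit_def power2_eq_square field_simps)
next
  case False
  have diff: "utility 0 MaxDiff \<beta> t \<xi> ExplanationDom Firm1 c - utility 0 MaxDiff \<beta> t \<xi> ExplanationDom Firm2 c
      = t * (1 - \<xi>) * (1 - 2 * fst c)" if "c \<in> customers" for c
    using that by (cases c) (auto simp: utility_def customers_def algebra_simps)
  have sgn: "0 < t * (1 - \<xi>)" using assms False by simp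
  have cmp: "utility 0 MaxDiff \<beta> t \<xi> ExplanationDom Firm1 c > utility 0 MaxDiff \<beta> t \<xi> ExplanationDom Firm2 c
        \<longleftrightarrow> fst c < 1 / 2"
      "utility 0 MaxDiff \<beta> t \<xi> ExplanationDom Firm1 c < utility 0 MaxDiff \<beta> t \<xi> ExplanationDom Firm2 c
        \<longleftrightarrow> fst c > 1 / 2"
      "utility 0 MaxDiff \<beta> t \<xi> ExplanationDom Firm1 c = utility 0 MaxDiff \<beta> t \<xi> ExplanationDom Firm2 c
        \<longleftrightarrow> fst c = 1 / 2" if "c \<in> customers" for c
    using diff[OF that] zero_less_mult_iff[of "t * (1 - \<xi>)" "1 - 2 * fst c"]
      mult_less_0_iff[of "t * (1 - \<xi>)" "1 - 2 * fst c"]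
      mult_eq_0_iff[of "t * (1 - \<xi>)" "1 - 2 * fst c"] sgn
    by linarith+
  have sets: "{c \<in> customers. utility 0 MaxDiff \<beta> t \<xi> ExplanationDom Firm1 c > utility 0 MaxDiff \<beta> t \<xi> ExplanationDom Firm2 c}
        = {0..<1 / 2} \<times> {0..1}"
      "{c \<in> customers. utility 0 MaxDiff \<beta> t \<xi> ExplanationDom Firm1 c < utility 0 MaxDiff \<beta> t \<xi> ExplanationDom Firm2 c}
        = {1 / 2<..1} \<times> {0..1}"
      "{c \<in> customers. utility 0 MaxDiff \<beta> t \<xi> ExplanationDom Firm1 c = utility 0 MaxDiff \<beta> t \<xi> ExplanationDom Firm2 c}
        = {1 / 2} \<times> {0..1}"
    using cmp by (auto simp: customers_def)
  have box: "measure lborel (A \<times> {0..1::real}) = measure lborel A" if "A \<in> sets borel" for A :: "real set"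
    using that lborel.emeasure_pair_measure_Times[of A lborel "{0..1::real}"]
    by (simp add: measure_def lborel_prod)
  have "demand MaxDiff \<beta> t \<xi> ExplanationDom Firm1 = 1 / 2"
    using sets by (simp add: demand_def box)
  moreover have "demand MaxDiff \<beta> t \<xi> ExplanationDom Firm2 = 1 / 2"
    using sets by (simp add: demand_def box eq_commute[of "utility 0 MaxDiff \<beta> t \<xi> ExplanationDom Firm2 _"])
  moreover have "\<beta> * (1 / (12 * \<beta>))\<^sup>2 = 1 / (144 * \<beta>)"
    using assms by (simp add: power2_eq_square)
  ultimately show ?thesis
    by (cases i) (simp_all add: market_profit_def)
qed

end

theory Submission
  imports Defs
begin

text \<open>Take \<open>\<beta> = t = 1\<close>. Full explanations are ruinous at these parameters: the quality-dominated
  market is impossible because \<open>\<beta> t \<ge> 4 / 9\<close>, and the explanation-dominated one, possible only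
  under \<open>MaxDiff\<close>, has price \<open>0\<close> and hence negative profits, so there is no market. At the level
  \<open>\<xi> = 0\<close> there is one with positive profits, and every customer's utility is positive.\<close>

text \<open>By compactness \<open>f\<close> attains a positive minimum \<open>f a\<close> on
  \<open>S\<close>, and the integral is at least \<open>f a\<close> times the measure of
  \<open>S\<close>.\<close>

lemma set_integral_pos_compact:
  fixes f :: "'a::euclidean_space \<Rightarrow> real"
  assumes S: "compact S" "0 < measure lborel S" and f: "continuous_on S f"
    and pos: "\<And>x. x \<in> S \<Longrightarrow> 0 < f x"
  shows "0 < (LINT x:S|lborel. f x)"
proof -
  have "S \<noteq> {}" using S(2) by auto
  then obtain a where a: "a \<in> S" "\<And>x. x \<in> S \<Longrightarrow> f a \<le> f x"
    using continuous_attains_inf[OF S(1) _ f] by blast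
  have int: "set_integrable lborel S g" if "continuous_on S g" for g :: "'a \<Rightarrow> real"
    using borel_integrable_compact[OF S(1) that]
    by (simp add: set_integrable_def indicator_scaleR_eq_if)
  have "0 < measure lborel S * f a" using S(2) pos[OF a(1)] by simp
  also have "\<dots> = (LINT x:S|lborel. f a)"
    using S(1) by (simp add: set_lebesgue_integral_def borel_compact emeasure_compact_finite)
  also have "\<dots> \<le> (LINT x:S|lborel. f x)"
    using a(2) by (intro set_integral_mono int f continuous_on_const)
  finally show ?thesis .
qed

lemma total_utility_pos:
  assumes "reservation_large V h \<beta> t \<xi>" "outcome h \<beta> t \<xi> (Some m)"
  shows "0 < total_utility V h \<beta> t \<xi> (Some m)"
proof -
  have box: "customers = cbox (0, 0) (1, 1)"
    by (auto simp: customers_def)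
  have "0 < (LINT c:customers|lborel. customer_utility V h \<beta> t \<xi> m c)"
  proof (rule set_integral_pos_compact)
    show "compact customers" by (simp only: box compact_cbox)
    show "0 < measure lborel customers"
      by (simp add: customers_def lborel_prod[symmetric] measure_def
          lborel.emeasure_pair_measure_Times)
    show "continuous_on customers (customer_utility V h \<beta> t \<xi> m)"
      unfolding customer_utility_def utility_def case_prod_beta by (intro continuous_intros)
    show "0 < customer_utility V h \<beta> t \<xi> m c" if "c \<in> customers" for c
      using assms that unfolding reservation_large_def by blast
  qed
  then show ?thesis by simp
qed

lemma outcome_full_explanation:
  assumes "\<beta> > 0" "4 / 9 \<le> \<beta> * t" "outcome h \<beta> t 1 M"
  shows "M = None"
proof (cases M)
  case (Some m)
  then have "chosen_market h \<beta> t 1 m" "0 \<le> equilibrium_profit \<beta> t 1 m Firm1"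
    using assms(3) by auto
  then show ?thesis
    using assms(1,2) by (cases m) (auto simp: chosen_market_def)
qed

lemma outcome_no_explanation:
  assumes "outcome h 1 1 0 M"
  shows "M = Some (if h = MaxDiff then ExplanationDom else QualityDom)"
proof -
  \<comment> \<open>Under \<open>MaxDiff\<close> both markets are possible, but the
    explanation-dominated one earns each firm 1/2 - 1/144, against 4/81 and 2/81.\<close>
  have chosen: "chosen_market h 1 1 0 m \<longleftrightarrow> m = (if h = MaxDiff then ExplanationDom else QualityDom)"
    for m
    by (cases m) (auto simp: chosen_market_def ex_market all_firm ex_firm)
  \<comment> \<open>Profits are never negative and some market is possible, so both ways to reach
    \<open>None\<close> fail.\<close>
  have "0 \<le> equilibrium_profit 1 1 0 m i" for m i
    by (cases m; cases i) auto
  moreover have "market_possible h 1 1 0 QualityDom" by simp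
  ultimately have "M \<noteq> None"
    using assms by (metis outcome.simps(1) not_less)
  then show ?thesis
    using assms chosen by auto
qed

lemma market_profit_no_explanation_pos:
  "0 < market_profit h 1 1 0 (if h = MaxDiff then ExplanationDom else QualityDom) i"
proof (cases h)
  case MaxDiff
  then show ?thesis by (simp add: market_profit_explanation)
next
  case MinDiff
  \<comment> \<open>Both firms sit at 1/2, so misfit costs cancel and, for every x, indifference
    means \<theta> * 2/9 = 4/27 - 2/27, that is, \<theta> = 1/3.\<close>
  then have "quality_dominated h 1 1 0 QualityDom"
    by (auto simp: quality_dominated_def utility_def intro!: bexI[of _ "1 / 3"])
  then show ?thesis
    using MinDiff by (cases i) (simp_all add: market_profit_quality)
qed

theorem proposition4:
  fixes h :: differentiation
  shows "\<exists>\<beta> t \<xi> :: real. \<beta> > 0 \<and> t > 0 \<and> 0 \<le> \<xi> \<and> \<xi> < 1 \<and>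
    (\<forall>V. reservation_large V h \<beta> t \<xi> \<and> reservation_large V h \<beta> t 1 \<longrightarrow>
      (\<forall>M M1. outcome h \<beta> t \<xi> M \<and> outcome h \<beta> t 1 M1 \<longrightarrow>
         (\<forall>i. profit h \<beta> t 1 M1 i < profit h \<beta> t \<xi> M i) \<and>
         total_utility V h \<beta> t 1 M1 < total_utility V h \<beta> t \<xi> M))"
proof (rule exI[of _ 1], rule exI[of _ 1], rule exI[of _ 0], intro conjI allI impI; (elim conjE)?)
  fix V M M1
  assume V: "reservation_large V h 1 1 0" and out: "outcome h 1 1 0 M" "outcome h 1 1 1 M1"
  note M = outcome_no_explanation[OF out(1)]
  have M1: "M1 = None" using outcome_full_explanation[OF _ _ out(2)] by simp
  show "profit h 1 1 1 M1 i < profit h 1 1 0 M i" for i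
    using market_profit_no_explanation_pos by (simp only: M M1 profit.simps)
  \<comment> \<open>Without a market total utility is 0, so positivity at level 0 suffices.\<close>
  show "total_utility V h 1 1 1 M1 < total_utility V h 1 1 0 M"
    using total_utility_pos[OF V] out(1) unfolding M M1 by (simp only: total_utility.simps(1))
qed simp_all

end
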